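(* Let $n\ge2$ and let $E\subset\mathbb{R}^n$ be a closed set with $|E|=0$. Then $$\overline{\dim}_A(E)=n-\sup\{0\le s\le n:\ E\text{ has the property }P(s)\}.$$ In particular, $E$ has the property $P(s)$ for all $0\le s<n-\overline{\dim}_A(E)$.
   Context: $|A|$ is the Lebesgue $n$-measure of $A$, $d(A)$ is the diameter of $A$, $\delta_E(x)=\operatorname{dist}(x,E)$ (with $\inf\emptyset=+\infty$), $B(x,R)$ is the open ball, and $E_\eta=\{x\in\mathbb{R}^n:\delta_E(x)<\eta\}$ is the open $\eta$-neighborhood of $E$ (so $E_0=\emptyset$). Property $P(s)$: let $0\le s\le n$. A closed set $E\subset\mathbb{R}^n$ has the property $P(s)$ if $|E|=0$ and there is a constant $C>0$ such that $$|B\cap(E_{\eta_2}\setminus E_{\eta_1})|\le C\,\eta_2^{s-1}(\eta_2-\eta_1)\,d(B)^{n-s}\quad\text{if }1\le s\le n,$$ and $$|B\cap(E_{\eta_2}\setminus E_{\eta_1})|\le C\,(\eta_2-\eta_1)^{s}\,d(B)^{n-s}\quad\text{if }0\le s<1,$$ for all balls $B$ and all numbers $\eta_1,\eta_2$ satisfying $0\le\eta_1<\eta_2\le d(B)$. For bounded $A\subset\mathbb{R}^n$ and $r>0$, $N(A,r)$ is the minimal number of open balls of radius $r$ centered at points of $A$ needed to cover $A$. The (upper) Assouad dimension is $\overline{\dim}_A(E)=\inf\{\lambda\ge 0:\ \exists\, C_\lambda>0 \text{ such that } N(E\cap B(x,R),r)\le C_\lambda (r/R)^{-\lambda}\text{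 for all } x\in E,\ 0<r<R<d(E)\}$. *)

theory Defs
  imports "HOL-Analysis.Analysis"
begin

(* The library's "infdist x {}" is 0; here the infimum over {} is +infinity,
   so the distance to a set takes values in ennreal. *)
definition dist_to :: "(real ^ 'n) set \<Rightarrow> real ^ 'n \<Rightarrow> ennreal" where
  "dist_to E x = (INF y\<in>E. ennreal (dist x y))"

definition nbhd :: "(real ^ 'n) set \<Rightarrow> real \<Rightarrow> (real ^ 'n) set" where
  "nbhd E \<eta> = {x. dist_to E x < ennreal \<eta>}"

(* The library's "diameter" is 0 on unbounded sets.  This version is +infinity there
   and is used for E; for balls, which are bounded, "diameter" is the right notion. *)
definition ediam :: "(real ^ 'n) set \<Rightarrow> ennreal" where
  "ediam A = (SUP x\<in>A. SUP y\<in>A. ennreal (dist x y))"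

(* All bases of powr below are positive, as 0 \<le> \<eta>1 < \<eta>2 \<le> d(B).
   A ball of radius R \<le> 0 is empty and admits no such \<eta>1, \<eta>2. *)
definition property_P :: "(real ^ 'n) set \<Rightarrow> real \<Rightarrow> bool" where
  "property_P E s \<longleftrightarrow>
     emeasure lebesgue E = 0 \<and>
     (\<exists>C>0. \<forall>x R \<eta>1 \<eta>2.
        let B = ball x R in
        0 \<le> \<eta>1 \<longrightarrow> \<eta>1 < \<eta>2 \<longrightarrow> \<eta>2 \<le> diameter B \<longrightarrow>
        measure lebesgue (B \<inter> (nbhd E \<eta>2 - nbhd E \<eta>1)) \<le>
          (if 1 \<le> s
           then C * \<eta>2 powr (s - 1) * (\<eta>2 - \<eta>1) * diameter B powr (real CARD('n) - s)
           else C * (\<eta>2 - \<eta>1) powr s * diameter B powr (real CARD('n) - s)))"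

(* Meant for bounded A and r > 0, where a finite cover exists. *)
definition covering_number :: "(real ^ 'n) set \<Rightarrow> real \<Rightarrow> nat" where
  "covering_number A r =
     (LEAST k. \<exists>F. finite F \<and> F \<subseteq> A \<and> card F = k \<and> A \<subseteq> (\<Union>x\<in>F. ball x r))"

(* The set is never empty: a = n belongs to it, by comparing volumes of balls. *)
definition assouad_dim :: "(real ^ 'n) set \<Rightarrow> real" where
  "assouad_dim E =
     Inf {a. 0 \<le> a \<and>
       (\<exists>C>0. \<forall>x\<in>E. \<forall>r R. 0 < r \<longrightarrow> r < R \<longrightarrow> ennreal R < ediam E \<longrightarrow>
          real (covering_number (E \<inter> ball x R) r) \<le> C * (r / R) powr (- a))}"

end

theory Submission imports Defs begin

text \<open>
  The theorem follows from an equivalence at each single exponent: for \<open>0 \<le> s \<le> n\<close>, a null set \<open>E\<close>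
  has \<open>P(s)\<close> if and only if the covering numbers of \<open>E\<close> obey the bound that defines the Assouad
  dimension with exponent \<open>n - s\<close> (\<open>property_P_iff_covering_exponent\<close>).  Admissible exponents are
  closed upwards, so the infimum of the exponents and the supremum of the \<open>s\<close> then add up to \<open>n\<close>.

  That \<open>P(s)\<close> bounds covering numbers is a volume count using only \<open>\<eta>\<^sub>1 = 0\<close>: the balls of radius
  \<open>r/2\<close> around an \<open>r\<close>-separated subset of \<open>E \<inter> B(x,R)\<close> are disjoint and lie in
  \<open>B(x,2R) \<inter> E\<^sub>r\<close>, whose volume is at most a constant times \<open>r\<^sup>s R\<^bsup>n-s\<^esup>\<close>; a maximal separated
  subset consists of the centres of a cover.

  Conversely, put \<open>a = \<eta>\<^sub>1\<close> and \<open>b = \<eta>\<^sub>2\<close>.  A covering bound at scale \<open>b\<close> controls \<open>|B \<inter> E\<^sub>b|\<close>, but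
  \<open>P(s)\<close> requires the further factor \<open>(b - a)/b\<close> for the layer \<open>E\<^sub>b - E\<^sub>a\<close>.  The layer of a union is
  covered by the layers of the pieces, so it is enough to gain this factor for a piece \<open>A\<close> contained
  in a ball of radius \<open>b/2\<close> about a point \<open>p\<close>.  If \<open>a \<ge> b/2\<close>, the contraction about \<open>p\<close> with
  ratio \<open>t = (2a - b)/b\<close> maps \<open>A\<^sub>b\<close> into \<open>A\<^sub>a\<close>, so that
  \<open>|A\<^sub>b - A\<^sub>a| \<le> (1 - t\<^sup>n) |A\<^sub>b|\<close>, and Bernoulli's inequality gives the factor
  (\<open>measure_layer_le\<close>).  If \<open>a < b/2\<close>, the factor is bounded below and nothing has to be gained.
  For \<open>s < 1\<close> the required bound \<open>(b - a)\<^sup>s\<close> is weaker than \<open>b\<^bsup>s-1\<^esup> (b - a)\<close>.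
\<close>

section \<open>Neighbourhoods\<close>

lemma nbhd_eq_UN_ball: "nbhd E r = (\<Union>y\<in>E. ball y r)"
proof (cases "r \<le> 0")
  case True
  then show ?thesis by (auto simp: nbhd_def ennreal_neg not_less)
next
  case False
  then show ?thesis
    by (auto simp: nbhd_def dist_to_def INF_less_iff ennreal_less_iff dist_commute)
qed

lemma open_nbhd: "open (nbhd E r)"
  unfolding nbhd_eq_UN_ball by auto

lemma sets_nbhd [simp]: "nbhd E r \<in> sets lebesgue"
  using open_nbhd[of E r] by (simp add: borel_open)

lemma sets_layer [simp]: "ball x R \<inter> (nbhd E b - nbhd E a) \<in> sets lebesgue"
  by (intro sets.Int sets.Diff sets_nbhd) auto

lemma nbhd_0 [simp]: "nbhd E 0 = {}"
  by (simp add: nbhd_eq_UN_ball)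

lemma measure_ball_vec:
  fixes p :: "real ^ 'n"
  assumes "0 \<le> r"
  shows "measure lebesgue (ball p r) = unit_ball_vol CARD('n) * r ^ CARD('n)"
  using content_ball[OF assms, of p] by simp

lemma nbhd_subset_ball:
  assumes "A \<subseteq> ball p c"
  shows "nbhd A b \<subseteq> ball p (b + c)"
proof
  fix z assume "z \<in> nbhd A b"
  then obtain q where "q \<in> A" "dist q z < b" by (auto simp: nbhd_eq_UN_ball)
  moreover from this have "dist p q < c" using assms by auto
  ultimately show "z \<in> ball p (b + c)"
    using dist_triangle[of p z q] by simp
qed

lemma contraction_nbhd_subset:
  fixes A :: "(real ^ 'n) set"
  assumes A: "A \<subseteq> ball p (b/2)" and t: "0 \<le> t" "t < 1"
  shows "(\<lambda>z. t *\<^sub>R z + (1 - t) *\<^sub>R p) ` nbhd A b \<subseteq> nbhd A (t * b + (1 - t) * (b/2))"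
proof
  fix w assume "w \<in> (\<lambda>z. t *\<^sub>R z + (1 - t) *\<^sub>R p) ` nbhd A b"
  then obtain z q where w: "w = t *\<^sub>R z + (1 - t) *\<^sub>R p" and q: "q \<in> A" "dist q z < b"
    unfolding nbhd_eq_UN_ball by force
  have pq: "dist p q < b/2" using A q by auto
  have "w - q = t *\<^sub>R (z - q) + (1 - t) *\<^sub>R (p - q)"
    unfolding w by (simp add: algebra_simps)
  then have "norm (w - q) \<le> norm (t *\<^sub>R (z - q)) + norm ((1 - t) *\<^sub>R (p - q))"
    by (metis norm_triangle_ineq)
  also have "\<dots> = t * dist q z + (1 - t) * dist p q"
    using t by (simp add: dist_norm norm_minus_commute)
  also have "\<dots> < t * b + (1 - t) * (b/2)"
    using q pq t by (intro add_le_less_mono mult_left_mono mult_strict_left_mono) auto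
  finally show "w \<in> nbhd A (t * b + (1 - t) * (b/2))"
    using q by (auto simp: nbhd_eq_UN_ball dist_norm norm_minus_commute)
qed

text \<open>
  For \<open>a < b/2\<close> the bound holds because \<open>2 (b - a)/b > 1\<close>.  Otherwise the contraction ratio
  \<open>t = (2a - b)/b\<close> solves \<open>t b + (1 - t) b/2 = a\<close>, so it maps \<open>A\<^sub>b\<close> into \<open>A\<^sub>a\<close>, and
  \<open>1 - t = 2 (b - a)/b\<close>.
\<close>
lemma measure_layer_le:
  fixes A :: "(real ^ 'n) set"
  assumes A: "A \<subseteq> ball p (b/2)" and ab: "0 \<le> a" "a < b"
  shows "measure lebesgue (nbhd A b - nbhd A a) \<le>
    2 * real CARD('n) * ((b - a) / b) * (unit_ball_vol CARD('n) * (3 * b / 2) ^ CARD('n))"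
proof -
  let ?n = "CARD('n)" and ?V = "measure lebesgue (nbhd A b)"
  have n: "1 \<le> real ?n" by (simp add: Suc_leI)
  have sub: "nbhd A b \<subseteq> ball p (3 * b / 2)"
    using nbhd_subset_ball[OF A, of b] by (simp add: field_simps)
  have lm: "nbhd A b \<in> lmeasurable"
    by (rule fmeasurableI2[OF lmeasurable_ball sub]) simp
  have V_le: "?V \<le> unit_ball_vol ?n * (3 * b / 2) ^ ?n"
    using measure_mono_fmeasurable[OF sub _ lmeasurable_ball] measure_ball_vec[of "3 * b / 2" p] ab
    by simp
  have factor: "measure lebesgue (nbhd A b - nbhd A a) \<le> 2 * real ?n * ((b - a) / b) * ?V"
  proof (cases "a < b/2")
    case True
    then have "1 \<le> 2 * ((b - a) / b)" using ab by (simp add: field_simps)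
    also have "\<dots> \<le> 2 * real ?n * ((b - a) / b)"
      using n ab by (intro mult_right_mono) auto
    finally have "1 * ?V \<le> 2 * real ?n * ((b - a) / b) * ?V"
      by (intro mult_right_mono) auto
    moreover have "measure lebesgue (nbhd A b - nbhd A a) \<le> ?V"
      using lm by (intro measure_mono_fmeasurable) auto
    ultimately show ?thesis by simp
  next
    case False
    define t where "t = (2 * a - b) / b"
    have t: "0 \<le> t" "t < 1" using False ab by (auto simp: t_def field_simps)
    have t1: "1 - t = 2 * ((b - a) / b)" using ab by (simp add: t_def field_simps)
    have ta: "t * b + (1 - t) * (b/2) = a" using ab by (simp add: t_def field_simps)
    have nb: "nbhd A a \<subseteq> nbhd A b" using ab by (force simp: nbhd_eq_UN_ball)
    have lma: "nbhd A a \<in> lmeasurable"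
      by (rule fmeasurableI2[OF lm nb]) simp
    have contract: "t ^ ?n * ?V \<le> measure lebesgue (nbhd A a)"
    proof (cases "t = 0")
      case True
      then show ?thesis by (simp add: zero_power)
    next
      case False
      let ?f = "\<lambda>z. t *\<^sub>R z + (1 - t) *\<^sub>R p"
      have "open (?f ` nbhd A b)"
        using open_affinity[OF open_nbhd False, of "(1 - t) *\<^sub>R p" A b] by (simp add: add.commute)
      then have "measure lebesgue (?f ` nbhd A b) \<le> measure lebesgue (nbhd A a)"
        using contraction_nbhd_subset[OF A t] lma unfolding ta
        by (intro measure_mono_fmeasurable) auto
      then show ?thesis
        using measure_lebesgue_affine[of t "(1 - t) *\<^sub>R p" "nbhd A b"] t by simp
    qed
    have bern: "1 - t ^ ?n \<le> real ?n * (1 - t)"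
      using Bernoulli_inequality[of "t - 1" ?n] t by (simp add: algebra_simps)
    have "measure lebesgue (nbhd A b - nbhd A a) = ?V - measure lebesgue (nbhd A a)"
      using lm lma nb by (intro measurable_measure_Diff) auto
    also have "\<dots> \<le> (1 - t ^ ?n) * ?V" using contract by (simp add: algebra_simps)
    also have "\<dots> \<le> (real ?n * (1 - t)) * ?V" using bern by (intro mult_right_mono) auto
    finally show ?thesis unfolding t1 by (simp add: ac_simps)
  qed
  also have "\<dots> \<le> 2 * real ?n * ((b - a) / b) * (unit_ball_vol ?n * (3 * b / 2) ^ ?n)"
    using V_le ab by (intro mult_left_mono) auto
  finally show ?thesis .
qed

section \<open>Covers\<close>

text \<open>
  Volume bounds the cardinality of \<open>r\<close>-separated subsets of \<open>A\<close>, so one of largest cardinality exists;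
  a point of \<open>A\<close> that its \<open>r\<close>-balls miss could be added to it.
\<close>
lemma finite_cover_volume_bound:
  fixes A U :: "(real ^ 'n) set"
  assumes r: "0 < r" and U: "U \<in> lmeasurable" and AU: "\<And>y. y \<in> A \<Longrightarrow> ball y (r/2) \<subseteq> U"
  obtains F where "finite F" "F \<subseteq> A" "A \<subseteq> (\<Union>y\<in>F. ball y r)"
    "real (card F) * (unit_ball_vol CARD('n) * (r/2) ^ CARD('n)) \<le> measure lebesgue U"
proof -
  let ?v = "unit_ball_vol CARD('n) * (r/2) ^ CARD('n)"
  define sep where
    "sep F \<longleftrightarrow> finite F \<and> F \<subseteq> A \<and> (\<forall>x\<in>F. \<forall>y\<in>F. x \<noteq> y \<longrightarrow> r \<le> dist x y)" for F
  have v: "0 < ?v" using r by simp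
  have vol: "real (card F) * ?v \<le> measure lebesgue U" if F: "sep F" for F
  proof -
    have "disjoint_family_on (\<lambda>y. ball y (r/2)) F"
      unfolding disjoint_family_on_def
    proof (intro ballI impI)
      fix x y assume "x \<in> F" "y \<in> F" "x \<noteq> y"
      then have "r \<le> dist x y" using F by (auto simp: sep_def)
      then show "ball x (r/2) \<inter> ball y (r/2) = {}" by (intro disjoint_ballI) simp
    qed
    then have "measure lebesgue (\<Union>y\<in>F. ball y (r/2)) = (\<Sum>y\<in>F. measure lebesgue (ball y (r/2)))"
      using F emeasure_lborel_ball_finite
      by (intro measure_finite_Union) (auto simp: sep_def less_top[symmetric])
    also have "\<dots> = real (card F) * ?v" using measure_ball_vec[of "r/2", where ?'n = 'n] r by simp
    finally have "real (card F) * ?v = measure lebesgue (\<Union>y\<in>F. ball y (r/2))" ..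
    also have "\<dots> \<le> measure lebesgue U"
      using F AU U by (intro measure_mono_fmeasurable) (auto simp: sep_def)
    finally show ?thesis .
  qed
  have bound: "card F \<le> nat \<lfloor>measure lebesgue U / ?v\<rfloor>" if "sep F" for F
    using vol[OF that] v by (simp add: le_nat_floor pos_le_divide_eq)
  have "sep {}" by (simp add: sep_def)
  then obtain F where F: "sep F" and max: "\<And>G. sep G \<Longrightarrow> card G \<le> card F"
    using ex_has_greatest_nat[of sep "{}" card] bound le_imp_less_Suc by blast
  have "A \<subseteq> (\<Union>y\<in>F. ball y r)"
  proof
    fix z assume z: "z \<in> A"
    show "z \<in> (\<Union>y\<in>F. ball y r)"
    proof (rule ccontr)
      assume "z \<notin> (\<Union>y\<in>F. ball y r)"
      then have far: "\<forall>y\<in>F. r \<le> dist y z" by auto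
      then have "z \<notin> F" using r by force
      moreover have "sep (insert z F)"
        using F z far by (auto simp: sep_def dist_commute)
      ultimately show False using max[of "insert z F"] F by (simp add: sep_def)
    qed
  qed
  moreover have "finite F" "F \<subseteq> A" using F by (simp_all add: sep_def)
  ultimately show ?thesis using vol[OF F] by (intro that)
qed

lemma finite_cover_of_bounded:
  fixes A :: "(real ^ 'n) set"
  assumes "bounded A" "0 < r"
  obtains F where "finite F" "F \<subseteq> A" "A \<subseteq> (\<Union>y\<in>F. ball y r)"
proof -
  obtain c where c: "A \<subseteq> ball 0 c" using assms bounded_subset_ballD by blast
  have "ball y (r/2) \<subseteq> ball 0 (r/2 + c)" if "y \<in> A" for y
    using nbhd_subset_ball[OF c, of "r/2"] that by (auto simp: nbhd_eq_UN_ball)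
  from finite_cover_volume_bound[OF assms(2) lmeasurable_ball this]
  obtain F where "finite F" "F \<subseteq> A" "A \<subseteq> (\<Union>y\<in>F. ball y r)" .
  then show ?thesis by (rule that)
qed

lemma covering_number_le_card:
  assumes "finite F" "F \<subseteq> A" "A \<subseteq> (\<Union>x\<in>F. ball x r)"
  shows "covering_number A r \<le> card F"
  unfolding covering_number_def using assms by (intro Least_le) blast

lemma covering_number_attained:
  assumes "bounded A" "0 < r"
  obtains F where "finite F" "F \<subseteq> A" "A \<subseteq> (\<Union>x\<in>F. ball x r)" "card F = covering_number A r"
proof -
  obtain G where "finite G" "G \<subseteq> A" "A \<subseteq> (\<Union>y\<in>G. ball y r)"
    using finite_cover_of_bounded[OF assms] .
  then have "\<exists>F. finite F \<and> F \<subseteq> A \<and> card F = card G \<and> A \<subseteq> (\<Union>x\<in>F. ball x r)" by blast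
  from LeastI[of "\<lambda>k. \<exists>F. finite F \<and> F \<subseteq> A \<and> card F = k \<and> A \<subseteq> (\<Union>x\<in>F. ball x r)", OF this]
  have "\<exists>F. finite F \<and> F \<subseteq> A \<and> card F = covering_number A r \<and> A \<subseteq> (\<Union>x\<in>F. ball x r)"
    unfolding covering_number_def .
  then show ?thesis by (elim exE conjE) (rule that)
qed

section \<open>Covering exponents\<close>

definition covering_exponent :: "(real ^ 'n) set \<Rightarrow> real \<Rightarrow> bool" where
  "covering_exponent E a \<longleftrightarrow>
     (\<exists>C>0. \<forall>x\<in>E. \<forall>r R. 0 < r \<longrightarrow> r < R \<longrightarrow> ennreal R < ediam E \<longrightarrow>
        real (covering_number (E \<inter> ball x R) r) \<le> C * (r / R) powr (- a))"

lemma assouad_dim_eq_Inf: "assouad_dim E = Inf {a. 0 \<le> a \<and> covering_exponent E a}"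
  unfolding assouad_dim_def covering_exponent_def ..

lemma covering_exponentE:
  assumes "covering_exponent E a"
  obtains C where "0 < C" "\<And>x r R. x \<in> E \<Longrightarrow> 0 < r \<Longrightarrow> r < R \<Longrightarrow> ennreal R < ediam E \<Longrightarrow>
      real (covering_number (E \<inter> ball x R) r) \<le> C * (r / R) powr (- a)"
proof -
  from assms obtain C where "0 < C" and C: "\<forall>x\<in>E. \<forall>r R. 0 < r \<longrightarrow> r < R \<longrightarrow> ennreal R < ediam E \<longrightarrow>
      real (covering_number (E \<inter> ball x R) r) \<le> C * (r / R) powr (- a)"
    unfolding covering_exponent_def by blast
  then show ?thesis by (intro that[of C] C[rule_format])
qed

lemma covering_exponentI:
  assumes "0 < C" "\<And>x r R. x \<in> E \<Longrightarrow> 0 < r \<Longrightarrow> r < R \<Longrightarrow> ennreal R < ediam E \<Longrightarrow>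
      real (covering_number (E \<inter> ball x R) r) \<le> C * (r / R) powr (- a)"
  shows "covering_exponent E a"
  unfolding covering_exponent_def using assms by (intro exI[of _ C] conjI ballI allI impI)

lemma covering_exponent_mono:
  assumes "covering_exponent E a" "a \<le> b"
  shows "covering_exponent E b"
proof -
  obtain C where C: "0 < C" "\<And>x r R. x \<in> E \<Longrightarrow> 0 < r \<Longrightarrow> r < R \<Longrightarrow> ennreal R < ediam E \<Longrightarrow>
      real (covering_number (E \<inter> ball x R) r) \<le> C * (r / R) powr (- a)"
    using covering_exponentE[OF assms(1)] by blast
  show ?thesis
  proof (rule covering_exponentI[OF C(1)])
    fix x r R assume A: "x \<in> E" "0 < r" "r < R" "ennreal R < ediam E"
    have "C * (r / R) powr (- a) \<le> C * (r / R) powr (- b)"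
      using A C(1) assms(2) by (intro mult_left_mono powr_mono') auto
    with C(2)[OF A] show "real (covering_number (E \<inter> ball x R) r) \<le> C * (r / R) powr (- b)"
      by linarith
  qed
qed

text \<open>
  The bound in the definition concerns only scales \<open>R < d(E)\<close>.  Larger \<open>R\<close> occur only for bounded
  \<open>E\<close>, and such an \<open>E\<close> is a finite union of pieces \<open>E \<inter> ball g (d(E)/2)\<close> to which the bound does apply;
  their number is a constant of \<open>E\<close>.  If \<open>d(E) = 0\<close>, there are no scales \<open>R < d(E)\<close>, but then
  \<open>E\<close> has at most one point.
\<close>
lemma covering_exponent_all_scales:
  fixes E :: "(real ^ 'n) set"
  assumes exp: "covering_exponent E a" and a: "0 \<le> a"
  obtains C where "0 < C" "\<And>x r R. x \<in> E \<Longrightarrow> 0 < r \<Longrightarrow> r < R \<Longrightarrow>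
     \<exists>F. finite F \<and> E \<inter> ball x R \<subseteq> (\<Union>y\<in>F. ball y r) \<and> real (card F) \<le> C * (r / R) powr (- a)"
proof -
  obtain C where C: "0 < C" "\<And>x r R. x \<in> E \<Longrightarrow> 0 < r \<Longrightarrow> r < R \<Longrightarrow> ennreal R < ediam E \<Longrightarrow>
      real (covering_number (E \<inter> ball x R) r) \<le> C * (r / R) powr (- a)"
    using covering_exponentE[OF exp] by blast
  have small: "\<exists>F. finite F \<and> E \<inter> ball x R \<subseteq> (\<Union>y\<in>F. ball y r) \<and> real (card F) \<le> C * (r / R) powr (- a)"
    if "x \<in> E" "0 < r" "r < R" "ennreal R < ediam E" for x r R
  proof -
    have "bounded (E \<inter> ball x R)" by (simp add: bounded_Int)
    from covering_number_attained[OF this \<open>0 < r\<close>]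
    obtain F where "finite F" "F \<subseteq> E \<inter> ball x R" "E \<inter> ball x R \<subseteq> (\<Union>y\<in>F. ball y r)"
        "card F = covering_number (E \<inter> ball x R) r" .
    then show ?thesis using C(2)[OF that] by (intro exI[of _ F]) simp
  qed
  show ?thesis
  proof (cases "ediam E = top")
    case True
    then show ?thesis by (intro that[OF C(1)] small) simp_all
  next
    case False
    define d where "d = enn2real (ediam E)"
    have d: "ediam E = ennreal d" "0 \<le> d" using False by (auto simp: d_def less_top)
    have dist_le: "dist x y \<le> d" if "x \<in> E" "y \<in> E" for x y
    proof -
      have "ennreal (dist x y) \<le> ediam E"
        unfolding ediam_def using that by (intro SUP_upper2[of x] SUP_upper2[of y]) auto
      then show ?thesis using d by simp
    qed
    have ge1: "1 \<le> (r / R) powr (- a)" if "0 < r" "r < R" for r R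
      using powr_mono'[of "- a" 0 "r / R"] that a by simp
    show ?thesis
    proof (cases "d = 0")
      case True
      show ?thesis
      proof (rule that[of 1])
        fix x r R assume x: "x \<in> E" and r: "0 < r" "r < (R::real)"
        have "E \<subseteq> {x}" using dist_le[OF x] True by auto
        then show "\<exists>F. finite F \<and> E \<inter> ball x R \<subseteq> (\<Union>y\<in>F. ball y r) \<and> real (card F) \<le> 1 * (r / R) powr (- a)"
          using r ge1[OF r] by (intro exI[of _ "{x}"]) auto
      qed simp
    next
      case False
      then have d0: "0 < d" using d by simp
      have "bounded E" using dist_le unfolding bounded_any_center bounded_def by blast
      from finite_cover_of_bounded[OF this half_gt_zero[OF d0]]
      obtain G where G: "finite G" "G \<subseteq> E" "E \<subseteq> (\<Union>y\<in>G. ball y (d/2))" .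
      define K where "K = real (card G)"
      have K: "0 \<le> K" by (simp add: K_def)
      \<comment> \<open>One summand for each case below: the hypothesis at \<open>R\<close> itself, the \<open>K\<close> pieces used directly
        as a cover, and each of the \<open>K\<close> pieces covered by the hypothesis at scale \<open>d/2\<close>.\<close>
      let ?C = "C + K + K * C"
      show ?thesis
      proof (rule that[of ?C])
        show "0 < ?C" using C(1) K by (simp add: add_pos_nonneg)
        fix x r R assume x: "x \<in> E" and r: "0 < r" "r < (R::real)"
        let ?w = "(r / R) powr (- a)"
        have w: "1 \<le> ?w" by (rule ge1[OF r])
        have C_le: "C * ?w \<le> ?C * ?w" "K * ?w \<le> ?C * ?w" "K * C * ?w \<le> ?C * ?w"
          using C(1) K w by (auto intro!: mult_right_mono)
        consider "R < d" | "d/2 \<le> r" | "d \<le> R" "r < d/2" by linarith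
        then show "\<exists>F. finite F \<and> E \<inter> ball x R \<subseteq> (\<Union>y\<in>F. ball y r) \<and> real (card F) \<le> ?C * ?w"
        proof cases
          case 1
          then have "ennreal R < ediam E" using d r by (simp add: ennreal_less_iff)
          from small[OF x r this] obtain F where "finite F" "E \<inter> ball x R \<subseteq> (\<Union>y\<in>F. ball y r)"
              "real (card F) \<le> C * ?w" by (elim exE conjE)
          with C_le(1) show ?thesis by (intro exI[of _ F]) simp
        next
          case 2
          have "K \<le> K * ?w" using mult_left_mono[OF w K] by simp
          then have "real (card G) \<le> ?C * ?w" using C_le(2) by (simp add: K_def)
          moreover have "E \<inter> ball x R \<subseteq> (\<Union>y\<in>G. ball y r)" 
            using G(3) subset_ball[OF 2] by (meson UN_mono order_refl order_trans inf_le1)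
          ultimately show ?thesis using G(1) by (intro exI[of _ G]) simp
        next
          case 3
          have "ennreal (d/2) < ediam E" using d d0 by (simp add: ennreal_less_iff)
          then have "\<exists>F. finite F \<and> E \<inter> ball g (d/2) \<subseteq> (\<Union>y\<in>F. ball y r) \<and>
              real (card F) \<le> C * (r / (d/2)) powr (- a)" if "g \<in> G" for g
            using small[of g r "d/2"] that G(2) r 3 by blast
          then obtain F where F: "\<And>g. g \<in> G \<Longrightarrow> finite (F g)"
              "\<And>g. g \<in> G \<Longrightarrow> E \<inter> ball g (d/2) \<subseteq> (\<Union>y\<in>F g. ball y r)"
              "\<And>g. g \<in> G \<Longrightarrow> real (card (F g)) \<le> C * (r / (d/2)) powr (- a)"
            by metis
          have "(r / (d/2)) powr (- a) \<le> ?w"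
            using r 3 d0 a by (intro powr_mono2') (auto simp: field_simps)
          then have cardF: "real (card (F g)) \<le> C * ?w" if "g \<in> G" for g
            using F(3)[OF that] C(1) by (meson mult_left_mono less_imp_le order_trans)
          have "real (card (\<Union>g\<in>G. F g)) \<le> (\<Sum>g\<in>G. real (card (F g)))"
            using card_UN_le[OF G(1), of F] by (metis of_nat_le_iff of_nat_sum)
          also have "\<dots> \<le> K * (C * ?w)"
            using sum_bounded_above[of G "\<lambda>g. real (card (F g))", OF cardF] by (simp add: K_def)
          also have "\<dots> \<le> ?C * ?w" using C_le(3) by (simp add: mult.assoc)
          finally have "real (card (\<Union>g\<in>G. F g)) \<le> ?C * ?w" .
          moreover have "E \<inter> ball x R \<subseteq> (\<Union>y\<in>(\<Union>g\<in>G. F g). ball y r)"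
          proof
            fix z assume z: "z \<in> E \<inter> ball x R"
            then obtain g where "g \<in> G" "z \<in> ball g (d/2)" using G(3) by blast
            with z F(2)[of g] show "z \<in> (\<Union>y\<in>(\<Union>g\<in>G. F g). ball y r)" by blast
          qed
          ultimately show ?thesis using G(1) F(1) by (intro exI[of _ "\<Union>g\<in>G. F g"]) simp
        qed
      qed
    qed
  qed
qed

section \<open>The equivalence at each exponent\<close>

text \<open>
  The layer with \<open>\<eta>\<^sub>1 = 0\<close>, \<open>\<eta>\<^sub>2 = r\<close> of the ball of radius \<open>2 R\<close> contains the balls of radius
  \<open>r/2\<close> about all points of \<open>E \<inter> B(x,R)\<close>, so the volume bound for separated sets applies to it.
\<close>
lemma property_P_imp_covering_exponent:
  fixes E :: "(real ^ 'n) set"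
  assumes P: "property_P E s"
  shows "covering_exponent E (real CARD('n) - s)"
proof -
  let ?n = "CARD('n)" and ?\<omega> = "unit_ball_vol CARD('n)"
  obtain C where C: "0 < C" and layer: "\<And>x R \<eta>1 \<eta>2. 0 \<le> \<eta>1 \<Longrightarrow> \<eta>1 < \<eta>2 \<Longrightarrow> \<eta>2 \<le> diameter (ball x R) \<Longrightarrow>
      measure lebesgue (ball x R \<inter> (nbhd E \<eta>2 - nbhd E \<eta>1)) \<le>
          (if 1 \<le> s
           then C * \<eta>2 powr (s - 1) * (\<eta>2 - \<eta>1) * diameter (ball x R) powr (real ?n - s)
           else C * (\<eta>2 - \<eta>1) powr s * diameter (ball x R) powr (real ?n - s))"
    using P unfolding property_P_def Let_def by blast
  have \<omega>: "0 < ?\<omega>" by simp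
  then have \<omega>0: "?\<omega> \<noteq> 0" by linarith
  let ?C = "C * 4 powr (real ?n - s) * 2 ^ ?n / ?\<omega>"
  have "real (covering_number (E \<inter> ball x R) r) \<le> ?C * (r / R) powr (- (real ?n - s))"
    if r: "0 < r" "r < R" for x r R
  proof -
    let ?U = "ball x (2 * R) \<inter> nbhd E r"
    have U: "?U \<in> lmeasurable"
      by (rule fmeasurableI2[OF lmeasurable_ball]) auto
    have AU: "ball y (r/2) \<subseteq> ?U" if "y \<in> E \<inter> ball x R" for y
    proof
      fix z assume z: "z \<in> ball y (r/2)"
      then have "dist y z < r" "dist x z < 2 * R"
        using that r dist_triangle[of x z y] by auto
      then show "z \<in> ?U" using that by (auto simp: nbhd_eq_UN_ball)
    qed
    obtain F where F: "finite F" "F \<subseteq> E \<inter> ball x R" "E \<inter> ball x R \<subseteq> (\<Union>y\<in>F. ball y r)"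
        "real (card F) * (?\<omega> * (r/2) ^ ?n) \<le> measure lebesgue ?U"
      using finite_cover_volume_bound[OF r(1) U AU] .
    have "measure lebesgue ?U \<le> C * r powr s * (4 * R) powr (real ?n - s)"
    proof -
      have "r powr (s - 1) * r = r powr s"
        using r powr_add[of r "s - 1" 1] by simp
      then show ?thesis
        using layer[of 0 r x "2 * R"] r by (simp add: mult.assoc split: if_splits)
    qed
    with F(4) have "real (card F) * (?\<omega> * (r/2) ^ ?n) \<le> C * r powr s * (4 * R) powr (real ?n - s)"
      by linarith
    also have "\<dots> = ?C * (r / R) powr (- (real ?n - s)) * (?\<omega> * (r/2) ^ ?n)"
    proof -
      have "(r / R) powr (- (real ?n - s)) * r ^ ?n = r powr s * R powr (real ?n - s)"
        using r by (simp add: powr_divide powr_minus powr_diff powr_realpow divide_simps)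
      then show ?thesis
        using r \<omega>0 by (simp add: powr_mult power_divide)
    qed
    finally have "real (card F) \<le> ?C * (r / R) powr (- (real ?n - s))"
      using r \<omega> by (simp only: mult_le_cancel_right_pos zero_less_power mult_pos_pos half_gt_zero)
    then show ?thesis
      using covering_number_le_card[OF F(1-3)] by (meson of_nat_le_iff order_trans)
  qed
  moreover have "0 < ?C" using C \<omega> by simp
  ultimately show ?thesis by (rule covering_exponentI[rotated])
qed

text \<open>
  The covering radius \<open>b/2\<close> is the one for which every piece satisfies the hypothesis of the
  contraction estimate.  There are at most a constant times \<open>(b/R)\<^bsup>s-n\<^esup>\<close> pieces, each contributing
  at most a constant times \<open>((b - a)/b) b\<^sup>n\<close>.
\<close>
lemma covering_exponent_imp_layer_bound:
  fixes E :: "(real ^ 'n) set"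
  assumes s: "s \<le> real CARD('n)" and exp: "covering_exponent E (real CARD('n) - s)"
  obtains C where "0 < C" "\<And>x R a b. 0 \<le> a \<Longrightarrow> a < b \<Longrightarrow> b \<le> 2 * R \<Longrightarrow>
     measure lebesgue (ball x R \<inter> (nbhd E b - nbhd E a)) \<le>
       C * b powr (s - 1) * (b - a) * (2 * R) powr (real CARD('n) - s)"
proof -
  let ?n = "CARD('n)" and ?\<omega> = "unit_ball_vol CARD('n)"
  obtain C where C: "0 < C" and cover: "\<And>x r R. x \<in> E \<Longrightarrow> 0 < r \<Longrightarrow> r < R \<Longrightarrow>
     \<exists>F. finite F \<and> E \<inter> ball x R \<subseteq> (\<Union>y\<in>F. ball y r) \<and> real (card F) \<le> C * (r / R) powr (- (real ?n - s))"
    using covering_exponent_all_scales[OF exp] s by (metis diff_ge_0_iff_ge)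
  let ?K = "C * 6 powr (real ?n - s) * 2 * real ?n * ?\<omega> * (3/2) ^ ?n"
  have K: "0 < ?K" using C by simp
  have "measure lebesgue (ball x R \<inter> (nbhd E b - nbhd E a)) \<le>
       ?K * b powr (s - 1) * (b - a) * (2 * R) powr (real ?n - s)"
    if ab: "0 \<le> a" "a < b" and bR: "b \<le> 2 * R" for x R a b
  proof (cases "E \<inter> ball x (R + b) = {}")
    case True
    have "ball x R \<inter> nbhd E b = {}"
    proof (rule ccontr)
      assume "ball x R \<inter> nbhd E b \<noteq> {}"
      then obtain z y where "dist x z < R" "y \<in> E" "dist y z < b" by (auto simp: nbhd_eq_UN_ball)
      then have "y \<in> E \<inter> ball x (R + b)"
        using dist_triangle[of x y z] by (simp add: dist_commute)
      then show False using True by blast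
    qed
    then have "ball x R \<inter> (nbhd E b - nbhd E a) = {}" by blast
    then show ?thesis using K ab by simp
  next
    case False
    then obtain x0 where x0: "x0 \<in> E" "dist x x0 < R + b" by auto
    \<comment> \<open>Every point of \<open>E\<close> within distance \<open>b\<close> of \<open>ball x R\<close> is within \<open>2 (R + b) \<le> 6 R\<close> of \<open>x0\<close>,
      and \<open>x0\<close>, unlike \<open>x\<close>, belongs to \<open>E\<close>.\<close>
    have "0 < b/2" "b/2 < 6 * R" using ab bR by auto
    from cover[OF x0(1) this] obtain F where F: "finite F"
        "E \<inter> ball x0 (6 * R) \<subseteq> (\<Union>p\<in>F. ball p (b/2))"
        "real (card F) \<le> C * ((b/2) / (6 * R)) powr (- (real ?n - s))"
      by blast
    define A where "A p = E \<inter> ball p (b/2)" for p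
    let ?L = "\<lambda>p. nbhd (A p) b - nbhd (A p) a"
    let ?m = "2 * real ?n * ((b - a) / b) * (?\<omega> * (3 * b / 2) ^ ?n)"
    have sub: "ball x R \<inter> (nbhd E b - nbhd E a) \<subseteq> (\<Union>p\<in>F. ?L p)"
    proof
      fix z assume z: "z \<in> ball x R \<inter> (nbhd E b - nbhd E a)"
      then obtain y where y: "y \<in> E" "dist y z < b" by (auto simp: nbhd_eq_UN_ball)
      have "dist x0 y < 6 * R"
        using z y x0 bR dist_triangle[of x0 y x] dist_triangle[of x y z] by (simp add: dist_commute)
      then obtain p where p: "p \<in> F" "y \<in> A p" using y F(2) by (auto simp: A_def)
      then have "z \<in> nbhd (A p) b" using y by (auto simp: nbhd_eq_UN_ball)
      moreover have "z \<notin> nbhd (A p) a" using z by (auto simp: nbhd_eq_UN_ball A_def)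
      ultimately show "z \<in> (\<Union>p\<in>F. ?L p)" using p by blast
    qed
    have lm: "?L p \<in> lmeasurable" for p
    proof (rule fmeasurableI2[OF lmeasurable_ball])
      show "?L p \<subseteq> ball p (b + b/2)" using nbhd_subset_ball[of "A p" p "b/2" b] by (auto simp: A_def)
    qed auto
    have "measure lebesgue (ball x R \<inter> (nbhd E b - nbhd E a)) \<le> measure lebesgue (\<Union>p\<in>F. ?L p)"
      using F(1) lm by (intro measure_mono_fmeasurable[OF sub] fmeasurable.finite_UN) auto
    also have "\<dots> \<le> (\<Sum>p\<in>F. measure lebesgue (?L p))"
      using F(1) lm by (intro measure_UNION_le) auto
    also have "\<dots> \<le> (\<Sum>p\<in>F. ?m)"
      using ab by (intro sum_mono measure_layer_le) (auto simp: A_def)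
    also have "\<dots> = real (card F) * ?m" by simp
    also have "\<dots> \<le> C * ((b/2) / (6 * R)) powr (- (real ?n - s)) * ?m"
      using F(3) ab by (intro mult_right_mono) auto
    also have "\<dots> = ?K * b powr (s - 1) * (b - a) * (2 * R) powr (real ?n - s)"
    proof -
      have scale: "(b / (6 * D)) powr (- (real ?n - s)) * (b ^ ?n / b)
          = 6 powr (real ?n - s) * b powr (s - 1) * D powr (real ?n - s)" if "0 < D" for D
        using ab that by (simp add: powr_divide powr_minus powr_diff powr_realpow powr_mult divide_simps)
      have "(b/2) / (6 * R) = b / (6 * (2 * R))" by simp
      then have power: "((b/2) / (6 * R)) powr (- (real ?n - s)) * (b ^ ?n / b)
          = 6 powr (real ?n - s) * b powr (s - 1) * (2 * R) powr (real ?n - s)"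
        using scale[of "2 * R"] ab bR by simp
      have "?m = 2 * real ?n * (b - a) * ?\<omega> * (3/2) ^ ?n * (b ^ ?n / b)"
        by (simp add: power_mult_distrib power_divide ac_simps)
      then have regroup: "C * X * ?m = C * 2 * real ?n * (b - a) * ?\<omega> * (3/2) ^ ?n * (X * (b ^ ?n / b))" for X
        by (simp only: ac_simps)
      show ?thesis unfolding regroup power by (simp only: ac_simps)
    qed
    finally show ?thesis .
  qed
  then show ?thesis using that[OF K] by blast
qed

lemma covering_exponent_imp_property_P:
  fixes E :: "(real ^ 'n) set"
  assumes null: "emeasure lebesgue E = 0" and s: "s \<le> real CARD('n)"
    and exp: "covering_exponent E (real CARD('n) - s)"
  shows "property_P E s"
proof -
  obtain C where C: "0 < C" and layer: "\<And>x R a b. 0 \<le> a \<Longrightarrow> a < b \<Longrightarrow> b \<le> 2 * R \<Longrightarrow>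
     measure lebesgue (ball x R \<inter> (nbhd E b - nbhd E a)) \<le>
       C * b powr (s - 1) * (b - a) * (2 * R) powr (real CARD('n) - s)"
    using covering_exponent_imp_layer_bound[OF s exp] by blast
  \<comment> \<open>Here the exponent \<open>s - 1\<close> is negative and \<open>b - a \<le> b\<close>.\<close>
  have thin: "b powr (s - 1) * (b - a) \<le> (b - a) powr s" if "0 \<le> a" "a < b" "s < 1" for a b :: real
  proof -
    have "b powr (s - 1) \<le> (b - a) powr (s - 1)"
      using that by (intro powr_mono2') auto
    then have "b powr (s - 1) * (b - a) \<le> (b - a) powr (s - 1) * (b - a)"
      using that by (intro mult_right_mono) auto
    also have "\<dots> = (b - a) powr s"
      using that powr_add[of "b - a" "s - 1" 1] by simp
    finally show ?thesis .
  qed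
  have "measure lebesgue (ball x R \<inter> (nbhd E b - nbhd E a)) \<le>
          (if 1 \<le> s
           then C * b powr (s - 1) * (b - a) * diameter (ball x R) powr (real CARD('n) - s)
           else C * (b - a) powr s * diameter (ball x R) powr (real CARD('n) - s))"
    if ab: "0 \<le> a" "a < b" "b \<le> diameter (ball x R)" for x R a b
  proof -
    have R: "diameter (ball x R) = 2 * R" and bR: "b \<le> 2 * R"
      using ab by (auto split: if_splits)
    show ?thesis
    proof (cases "1 \<le> s")
      case True
      then show ?thesis using layer[OF ab(1,2) bR, of x] unfolding R by simp
    next
      case False
      have "C * (b powr (s - 1) * (b - a)) * (2 * R) powr (real CARD('n) - s)
          \<le> C * (b - a) powr s * (2 * R) powr (real CARD('n) - s)"
        using C thin[OF ab(1,2)] False by (intro mult_right_mono mult_left_mono) auto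
      then show ?thesis
        using False layer[OF ab(1,2) bR, of x] unfolding R by (simp add: mult.assoc)
    qed
  qed
  then show ?thesis
    unfolding property_P_def Let_def using C null by blast
qed

theorem property_P_iff_covering_exponent:
  fixes E :: "(real ^ 'n) set"
  assumes "emeasure lebesgue E = 0" "s \<le> real CARD('n)"
  shows "property_P E s \<longleftrightarrow> covering_exponent E (real CARD('n) - s)"
  using property_P_imp_covering_exponent covering_exponent_imp_property_P[OF assms] by blast

text \<open>
  A layer of \<open>B\<close> has at most the volume of \<open>B\<close>, a constant times \<open>d(B)\<^sup>n\<close>.  Hence the supremum of
  the theorem and, by the equivalence, the infimum in the Assouad dimension are taken over
  nonempty sets.
\<close>
lemma property_P_0:
  fixes E :: "(real ^ 'n) set"
  assumes "emeasure lebesgue E = 0"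
  shows "property_P E 0"
proof -
  let ?n = "CARD('n)" and ?\<omega> = "unit_ball_vol CARD('n)"
  have "measure lebesgue (ball x R \<inter> (nbhd E b - nbhd E a)) \<le>
      (if 1 \<le> (0::real)
       then ?\<omega> * b powr (0 - 1) * (b - a) * diameter (ball x R) powr (real ?n - 0)
       else ?\<omega> * (b - a) powr 0 * diameter (ball x R) powr (real ?n - 0))"
    if ab: "0 \<le> a" "a < b" "b \<le> diameter (ball x R)" for x R a b
  proof -
    have R: "diameter (ball x R) = 2 * R" "0 < R" using ab by (auto split: if_splits)
    have "measure lebesgue (ball x R \<inter> (nbhd E b - nbhd E a)) \<le> measure lebesgue (ball x R)"
      by (intro measure_mono_fmeasurable) auto
    also have "\<dots> = ?\<omega> * R ^ ?n" using R by (intro measure_ball_vec) simp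
    also have "\<dots> \<le> ?\<omega> * (2 * R) ^ ?n" using R by (intro mult_left_mono power_mono) auto
    finally show ?thesis using R ab by (simp add: powr_realpow)
  qed
  moreover have "0 < ?\<omega>" by simp
  ultimately show ?thesis
    unfolding property_P_def Let_def using assms by blast
qed

theorem theorem3p4:
  fixes E :: "(real ^ 'n) set"
  assumes "CARD('n) \<ge> 2"
    and "closed E"
    and "emeasure lebesgue E = 0"
  shows "assouad_dim E = real CARD('n) - Sup {s. 0 \<le> s \<and> s \<le> real CARD('n) \<and> property_P E s} \<and>
         (\<forall>s. 0 \<le> s \<and> s < real CARD('n) - assouad_dim E \<longrightarrow> property_P E s)"
proof -
  let ?n = "real CARD('n)"
  let ?S = "{s. 0 \<le> s \<and> s \<le> ?n \<and> property_P E s}"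
  let ?D = "{a. 0 \<le> a \<and> covering_exponent E a}"
  have S0: "0 \<in> ?S" using property_P_0[OF assms(3)] by simp
  have bdd: "bdd_above ?S" "bdd_below ?D" by auto
  have SD: "?n - s \<in> ?D" if "s \<in> ?S" for s
    using that property_P_imp_covering_exponent[of E s] by simp
  have dim: "assouad_dim E = Inf ?D" by (rule assouad_dim_eq_Inf)
  have dim0: "0 \<le> assouad_dim E"
    unfolding dim using SD[OF S0] by (intro cInf_greatest) blast+
  have PS: "property_P E s" if "0 \<le> s" "s < ?n - assouad_dim E" for s
  proof -
    have "Inf ?D < ?n - s" using that dim by simp
    then obtain a where "covering_exponent E a" "a < ?n - s"
      using cInf_lessD[of ?D "?n - s"] SD[OF S0] by blast
    then have "covering_exponent E (?n - s)" using covering_exponent_mono by fastforce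
    then show ?thesis
      using property_P_iff_covering_exponent[OF assms(3)] that dim0 by simp
  qed
  have le: "s \<le> ?n - assouad_dim E" if "s \<in> ?S" for s
    using cInf_lower[OF SD[OF that] bdd(2)] unfolding dim by linarith
  have "Sup ?S = ?n - assouad_dim E"
  proof (rule antisym)
    show "Sup ?S \<le> ?n - assouad_dim E" using S0 le by (intro cSup_least) blast+
    show "?n - assouad_dim E \<le> Sup ?S"
    proof (rule dense_le)
      fix s assume s: "s < ?n - assouad_dim E"
      have "max 0 s \<in> ?S" if "0 \<le> s" using that s PS dim0 by simp
      moreover have "0 \<le> Sup ?S" by (rule cSup_upper[OF S0 bdd(1)])
      ultimately show "s \<le> Sup ?S"
        using cSup_upper[OF _ bdd(1), of "max 0 s"] by linarith
    qed
  qed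
  then show ?thesis using PS by auto
qed

end
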